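(* Every subdirectly irreducible SMMV-algebra is subdiagonal.
   Context: An MV-algebra is $\mathbf{A}=(A,\oplus,\neg,0)$ with $(A,\oplus,0)$ a commutative monoid, $\neg\neg x=x$, $x\oplus 1=1$ where $1=\neg 0$, and $(x\to y)\to y=(y\to x)\to x$ where $x\to y=\neg x\oplus y$. It is ordered by $x\le y$ iff $x\to y=1$; an MV-chain is a linearly ordered MV-algebra. An SMMV-algebra is a pair $(\mathbf{A},\tau)$ where $\mathbf{A}$ is an MV-algebra and $\tau$ is an idempotent endomorphism of $\mathbf{A}$, viewed as an algebra in the signature $(\oplus,\neg,0,\tau)$. An algebra is subdirectly irreducible if it is nontrivial and has a least congruence among those different from the identity congruence. An SMMV-algebra is diagonal if it has the form $(\mathbf{B}\times\mathbf{C},\tau)$ where $\mathbf{B},\mathbf{C}$ are MV-chains, $\mathbf{B}$ is a subalgebra of $\mathbf{C}$, and $\tau(b,c)=(b,b)$ for all $b\in B$, $c\in C$. An SMMV-algebra is subdiagonal if it is (isomorphic to) a subalgebra of a diagonal SMMV-algebra. *)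

theory Defs
  imports "HOL-Algebra.Group"
begin

section \<open>MV-algebras\<close>

record 'a mv_structure = "'a partial_object" +
  mv_add  :: "'a \<Rightarrow> 'a \<Rightarrow> 'a" (infixl \<open>\<oplus>\<index>\<close> 65)
  mv_neg  :: "'a \<Rightarrow> 'a" (\<open>\<sim>\<index> _\<close> [81] 80)
  mv_zero :: "'a" (\<open>\<zero>\<index>\<close>)

definition mv_one :: "('a, 'm) mv_structure_scheme \<Rightarrow> 'a" (\<open>\<one>\<^sub>M\<index>\<close>)
  where "\<one>\<^sub>M\<^bsub>A\<^esub> = \<sim>\<^bsub>A\<^esub> \<zero>\<^bsub>A\<^esub>"

definition mv_imp :: "('a, 'm) mv_structure_scheme \<Rightarrow> 'a \<Rightarrow> 'a \<Rightarrow> 'a" (infixr \<open>\<rightarrow>\<^sub>M\<index>\<close> 63)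
  where "x \<rightarrow>\<^sub>M\<^bsub>A\<^esub> y = (\<sim>\<^bsub>A\<^esub> x) \<oplus>\<^bsub>A\<^esub> y"

definition mv_le :: "('a, 'm) mv_structure_scheme \<Rightarrow> 'a \<Rightarrow> 'a \<Rightarrow> bool" (infix \<open>\<preceq>\<^sub>M\<index>\<close> 50)
  where "x \<preceq>\<^sub>M\<^bsub>A\<^esub> y \<longleftrightarrow> x \<rightarrow>\<^sub>M\<^bsub>A\<^esub> y = \<one>\<^sub>M\<^bsub>A\<^esub>"

locale mv_algebra =
  fixes A :: "('a, 'm) mv_structure_scheme" (structure)
  assumes add_comm_monoid: "comm_monoid \<lparr>carrier = carrier A, monoid.mult = mv_add A, one = mv_zero A\<rparr>"
    and neg_closed: "x \<in> carrier A \<Longrightarrow> \<sim> x \<in> carrier A"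
    and neg_neg: "x \<in> carrier A \<Longrightarrow> \<sim> (\<sim> x) = x"
    and add_one: "x \<in> carrier A \<Longrightarrow> x \<oplus> \<one>\<^sub>M = \<one>\<^sub>M"
    and imp_imp: "\<lbrakk>x \<in> carrier A; y \<in> carrier A\<rbrakk>
      \<Longrightarrow> (x \<rightarrow>\<^sub>M y) \<rightarrow>\<^sub>M y = (y \<rightarrow>\<^sub>M x) \<rightarrow>\<^sub>M x"

locale mv_chain = mv_algebra +
  assumes linear: "\<lbrakk>x \<in> carrier A; y \<in> carrier A\<rbrakk> \<Longrightarrow> x \<preceq>\<^sub>M y \<or> y \<preceq>\<^sub>M x"

definition mv_hom ::
  "('a, 'm) mv_structure_scheme \<Rightarrow> ('b, 'n) mv_structure_scheme \<Rightarrow> ('a \<Rightarrow> 'b) set"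
  where "mv_hom A B = {h. h \<in> carrier A \<rightarrow> carrier B \<and>
    (\<forall>x\<in>carrier A. \<forall>y\<in>carrier A. h (x \<oplus>\<^bsub>A\<^esub> y) = h x \<oplus>\<^bsub>B\<^esub> h y) \<and>
    (\<forall>x\<in>carrier A. h (\<sim>\<^bsub>A\<^esub> x) = \<sim>\<^bsub>B\<^esub> (h x)) \<and>
    h \<zero>\<^bsub>A\<^esub> = \<zero>\<^bsub>B\<^esub>}"

definition mv_subuniverse :: "'a set \<Rightarrow> ('a, 'm) mv_structure_scheme \<Rightarrow> bool"
  where "mv_subuniverse S A \<longleftrightarrow> S \<subseteq> carrier A \<and> \<zero>\<^bsub>A\<^esub> \<in> S \<and>
    (\<forall>x\<in>S. \<forall>y\<in>S. x \<oplus>\<^bsub>A\<^esub> y \<in> S) \<and> (\<forall>x\<in>S. \<sim>\<^bsub>A\<^esub> x \<in> S)"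


section \<open>SMMV-algebras\<close>

record 'a smmv_structure = "'a mv_structure" +
  smmv_tau :: "'a \<Rightarrow> 'a" (\<open>\<tau>\<index>\<close>)

locale smmv_algebra = mv_algebra A
  for A :: "('a, 'm) smmv_structure_scheme" (structure) +
  assumes tau_endo: "\<tau> \<in> mv_hom A A"
    and tau_idem: "x \<in> carrier A \<Longrightarrow> \<tau> (\<tau> x) = \<tau> x"

definition smmv_congruence :: "('a, 'm) smmv_structure_scheme \<Rightarrow> ('a \<times> 'a) set \<Rightarrow> bool"
  where "smmv_congruence A \<theta> \<longleftrightarrow> equiv (carrier A) \<theta> \<and>
    (\<forall>x x' y y'. (x, x') \<in> \<theta> \<longrightarrow> (y, y') \<in> \<theta> \<longrightarrow> (x \<oplus>\<^bsub>A\<^esub> y, x' \<oplus>\<^bsub>A\<^esub> y') \<in> \<theta>) \<and>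
    (\<forall>x x'. (x, x') \<in> \<theta> \<longrightarrow> (\<sim>\<^bsub>A\<^esub> x, \<sim>\<^bsub>A\<^esub> x') \<in> \<theta>) \<and>
    (\<forall>x x'. (x, x') \<in> \<theta> \<longrightarrow> (\<tau>\<^bsub>A\<^esub> x, \<tau>\<^bsub>A\<^esub> x') \<in> \<theta>)"

definition subdirectly_irreducible :: "('a, 'm) smmv_structure_scheme \<Rightarrow> bool"
  where "subdirectly_irreducible A \<longleftrightarrow>
    (\<exists>x\<in>carrier A. \<exists>y\<in>carrier A. x \<noteq> y) \<and>
    (\<exists>\<mu>. smmv_congruence A \<mu> \<and> \<mu> \<noteq> Id_on (carrier A) \<and>
      (\<forall>\<theta>. smmv_congruence A \<theta> \<and> \<theta> \<noteq> Id_on (carrier A) \<longrightarrow> \<mu> \<subseteq> \<theta>))"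

definition smmv_iso ::
  "('a, 'm) smmv_structure_scheme \<Rightarrow> ('b, 'n) smmv_structure_scheme \<Rightarrow> ('a \<Rightarrow> 'b) set"
  where "smmv_iso A B = {h. h \<in> mv_hom A B \<and>
    (\<forall>x\<in>carrier A. h (\<tau>\<^bsub>A\<^esub> x) = \<tau>\<^bsub>B\<^esub> (h x)) \<and>
    bij_betw h (carrier A) (carrier B)}"

definition smmv_subuniverse :: "'a set \<Rightarrow> ('a, 'm) smmv_structure_scheme \<Rightarrow> bool"
  where "smmv_subuniverse S A \<longleftrightarrow> mv_subuniverse S A \<and> (\<forall>x\<in>S. \<tau>\<^bsub>A\<^esub> x \<in> S)"


section \<open>Diagonal and subdiagonal SMMV-algebras\<close>

text \<open>The subalgebra \<open>B\<close> of \<open>C\<close> is represented by its universe, a subset of the carrier of \<open>C\<close>;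
  as an algebra it is \<open>C\<lparr>carrier := B\<rparr>\<close>.\<close>

definition diagonal_algebra :: "'c set \<Rightarrow> 'c mv_structure \<Rightarrow> ('c \<times> 'c) smmv_structure"
  where "diagonal_algebra B C = \<lparr>
    carrier = B \<times> carrier C,
    mv_add = (\<lambda>(b, c) (b', c'). (b \<oplus>\<^bsub>C\<^esub> b', c \<oplus>\<^bsub>C\<^esub> c')),
    mv_neg = (\<lambda>(b, c). (\<sim>\<^bsub>C\<^esub> b, \<sim>\<^bsub>C\<^esub> c)),
    mv_zero = (\<zero>\<^bsub>C\<^esub>, \<zero>\<^bsub>C\<^esub>),
    smmv_tau = (\<lambda>(b, c). (b, b))\<rparr>"

definition diagonal :: "('c \<times> 'c) smmv_structure \<Rightarrow> bool"
  where "diagonal D \<longleftrightarrow> (\<exists>B C. mv_chain C \<and> mv_subuniverse B C \<and>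
    mv_chain (C\<lparr>carrier := B\<rparr>) \<and> D = diagonal_algebra B C)"

text \<open>The type argument is the type from which the elements of the chains are drawn, since HOL
  cannot quantify existentially over types. The lemma \<open>subdiagonal_in_own_type\<close> below
  shows that taking the element type of the algebra itself is no restriction: it is
  the strongest instance, implied by every other one.\<close>

definition subdiagonal :: "'c itself \<Rightarrow> 'a smmv_structure \<Rightarrow> bool"
  where "subdiagonal _ A \<longleftrightarrow> smmv_algebra A \<and>
    (\<exists>(D :: ('c \<times> 'c) smmv_structure) S h.
      diagonal D \<and> smmv_subuniverse S D \<and> h \<in> smmv_iso A (D\<lparr>carrier := S\<rparr>))"

lemma (in mv_algebra) mv_laws:
  shows "\<zero> \<in> carrier A"
    and "x \<in> carrier A \<Longrightarrow> y \<in> carrier A \<Longrightarrow> x \<oplus> y \<in> carrier A"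
    and "x \<in> carrier A \<Longrightarrow> y \<in> carrier A \<Longrightarrow> z \<in> carrier A \<Longrightarrow> (x \<oplus> y) \<oplus> z = x \<oplus> (y \<oplus> z)"
    and "x \<in> carrier A \<Longrightarrow> y \<in> carrier A \<Longrightarrow> x \<oplus> y = y \<oplus> x"
    and "x \<in> carrier A \<Longrightarrow> \<zero> \<oplus> x = x"
    and "x \<in> carrier A \<Longrightarrow> x \<oplus> \<sim> \<zero> = \<sim> \<zero>"
    and "x \<in> carrier A \<Longrightarrow> y \<in> carrier A \<Longrightarrow>
      \<sim> (\<sim> x \<oplus> y) \<oplus> y = \<sim> (\<sim> y \<oplus> x) \<oplus> x"
proof -
  interpret M: comm_monoid "\<lparr>carrier = carrier A, monoid.mult = mv_add A, one = mv_zero A\<rparr>"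
    by (rule add_comm_monoid)
  show "\<zero> \<in> carrier A"
    and "x \<in> carrier A \<Longrightarrow> y \<in> carrier A \<Longrightarrow> x \<oplus> y \<in> carrier A"
    and "x \<in> carrier A \<Longrightarrow> y \<in> carrier A \<Longrightarrow> z \<in> carrier A \<Longrightarrow> (x \<oplus> y) \<oplus> z = x \<oplus> (y \<oplus> z)"
    and "x \<in> carrier A \<Longrightarrow> y \<in> carrier A \<Longrightarrow> x \<oplus> y = y \<oplus> x"
    and "x \<in> carrier A \<Longrightarrow> \<zero> \<oplus> x = x"
    using M.one_closed M.m_closed[of x y] M.m_assoc[of x y z] M.m_comm[of x y] M.l_one[of x]
    by simp_all
  show "x \<in> carrier A \<Longrightarrow> x \<oplus> \<sim> \<zero> = \<sim> \<zero>"
    using add_one[of x] by (simp add: mv_one_def)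
  show "x \<in> carrier A \<Longrightarrow> y \<in> carrier A \<Longrightarrow>
      \<sim> (\<sim> x \<oplus> y) \<oplus> y = \<sim> (\<sim> y \<oplus> x) \<oplus> x"
    using imp_imp[of x y] by (simp add: mv_imp_def)
qed

lemma mv_algebraI:
  fixes A (structure)
  assumes "\<zero> \<in> carrier A"
    and "\<And>x y. x \<in> carrier A \<Longrightarrow> y \<in> carrier A \<Longrightarrow> x \<oplus> y \<in> carrier A"
    and "\<And>x y z. x \<in> carrier A \<Longrightarrow> y \<in> carrier A \<Longrightarrow> z \<in> carrier A \<Longrightarrow>
      (x \<oplus> y) \<oplus> z = x \<oplus> (y \<oplus> z)"
    and comm: "\<And>x y. x \<in> carrier A \<Longrightarrow> y \<in> carrier A \<Longrightarrow> x \<oplus> y = y \<oplus> x"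
    and "\<And>x. x \<in> carrier A \<Longrightarrow> \<zero> \<oplus> x = x"
    and "\<And>x. x \<in> carrier A \<Longrightarrow> \<sim> x \<in> carrier A"
    and "\<And>x. x \<in> carrier A \<Longrightarrow> \<sim> (\<sim> x) = x"
    and "\<And>x. x \<in> carrier A \<Longrightarrow> x \<oplus> \<sim> \<zero> = \<sim> \<zero>"
    and "\<And>x y. x \<in> carrier A \<Longrightarrow> y \<in> carrier A \<Longrightarrow>
      \<sim> (\<sim> x \<oplus> y) \<oplus> y = \<sim> (\<sim> y \<oplus> x) \<oplus> x"
  shows "mv_algebra A"
proof (rule mv_algebra.intro)
  show "comm_monoid \<lparr>carrier = carrier A, monoid.mult = mv_add A, one = mv_zero A\<rparr>"
    by (rule comm_monoidI) (auto simp: assms(1-3,5) intro: comm)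
qed (simp_all add: mv_one_def mv_imp_def assms(6-9))

lemma mv_chain_subuniverse:
  assumes "mv_chain C" "mv_subuniverse B C"
  shows "mv_chain (C\<lparr>carrier := B\<rparr>)"
proof -
  interpret C: mv_chain C by fact
  have B: "\<zero>\<^bsub>C\<^esub> \<in> B" "\<And>x. x \<in> B \<Longrightarrow> x \<in> carrier C"
    "\<And>x y. x \<in> B \<Longrightarrow> y \<in> B \<Longrightarrow> x \<oplus>\<^bsub>C\<^esub> y \<in> B" "\<And>x. x \<in> B \<Longrightarrow> \<sim>\<^bsub>C\<^esub> x \<in> B"
    using assms(2) by (auto simp: mv_subuniverse_def)
  have "mv_algebra (C\<lparr>carrier := B\<rparr>)"
    by (rule mv_algebraI) (simp_all, (intro B C.mv_laws C.neg_neg; assumption)+)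
  moreover have "mv_chain_axioms (C\<lparr>carrier := B\<rparr>)"
    using C.linear B(2) by unfold_locales (simp add: mv_le_def mv_imp_def mv_one_def)
  ultimately show ?thesis
    by (rule mv_chain.intro)
qed

lemma mv_chain_transport:
  assumes "mv_chain C" and k: "\<And>x. x \<in> carrier C \<Longrightarrow> k (g x) = x"
  shows "mv_chain \<lparr>carrier = g ` carrier C, mv_add = (\<lambda>x y. g (k x \<oplus>\<^bsub>C\<^esub> k y)),
    mv_neg = (\<lambda>x. g (\<sim>\<^bsub>C\<^esub> (k x))), mv_zero = g \<zero>\<^bsub>C\<^esub>\<rparr>" (is "mv_chain ?T")
proof -
  interpret C: mv_chain C by fact
  note laws = C.mv_laws(1,2,3,5,6) C.neg_closed C.neg_neg
  have "mv_algebra ?T"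
  proof (rule mv_algebraI)
    show "x \<oplus>\<^bsub>?T\<^esub> y = y \<oplus>\<^bsub>?T\<^esub> x" if "x \<in> carrier ?T" "y \<in> carrier ?T" for x y
      using that by (auto simp: k C.mv_laws(4))
    show "\<sim>\<^bsub>?T\<^esub> (\<sim>\<^bsub>?T\<^esub> x \<oplus>\<^bsub>?T\<^esub> y) \<oplus>\<^bsub>?T\<^esub> y = \<sim>\<^bsub>?T\<^esub> (\<sim>\<^bsub>?T\<^esub> y \<oplus>\<^bsub>?T\<^esub> x) \<oplus>\<^bsub>?T\<^esub> x"
      if xy: "x \<in> carrier ?T" "y \<in> carrier ?T" for x y
    proof -
      obtain a b where "a \<in> carrier C" "b \<in> carrier C" "x = g a" "y = g b"
        using xy by auto
      then show ?thesis
        using C.mv_laws(7)[of a b] by (simp add: k laws)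
    qed
  qed (auto simp: k laws)
  moreover have "mv_chain_axioms ?T"
  proof
    fix x y assume "x \<in> carrier ?T" "y \<in> carrier ?T"
    then obtain a b where "a \<in> carrier C" "b \<in> carrier C" "x = g a" "y = g b"
      by auto
    then show "x \<preceq>\<^sub>M\<^bsub>?T\<^esub> y \<or> y \<preceq>\<^sub>M\<^bsub>?T\<^esub> x"
      using C.linear[of a b] by (auto simp: mv_le_def mv_imp_def mv_one_def k laws)
  qed
  ultimately show ?thesis
    by (rule mv_chain.intro)
qed

lemma smmv_algebra_diagonal_algebra:
  assumes "mv_chain C" "mv_subuniverse B C"
  shows "smmv_algebra (diagonal_algebra B C)"
proof -
  interpret C: mv_chain C by fact
  note laws = C.mv_laws(1,2,3,5,6) C.neg_closed C.neg_neg
  have B: "\<zero>\<^bsub>C\<^esub> \<in> B" "\<And>x. x \<in> B \<Longrightarrow> x \<in> carrier C"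
    "\<And>x y. x \<in> B \<Longrightarrow> y \<in> B \<Longrightarrow> x \<oplus>\<^bsub>C\<^esub> y \<in> B" "\<And>x. x \<in> B \<Longrightarrow> \<sim>\<^bsub>C\<^esub> x \<in> B"
    using assms(2) by (auto simp: mv_subuniverse_def)
  let ?D = "diagonal_algebra B C"
  have "mv_algebra ?D"
  proof (rule mv_algebraI)
    show "x \<oplus>\<^bsub>?D\<^esub> y = y \<oplus>\<^bsub>?D\<^esub> x" if "x \<in> carrier ?D" "y \<in> carrier ?D" for x y
      using that by (auto simp: diagonal_algebra_def B C.mv_laws(4))
    show "\<sim>\<^bsub>?D\<^esub> (\<sim>\<^bsub>?D\<^esub> x \<oplus>\<^bsub>?D\<^esub> y) \<oplus>\<^bsub>?D\<^esub> y = \<sim>\<^bsub>?D\<^esub> (\<sim>\<^bsub>?D\<^esub> y \<oplus>\<^bsub>?D\<^esub> x) \<oplus>\<^bsub>?D\<^esub> x"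
      if "x \<in> carrier ?D" "y \<in> carrier ?D" for x y
      using that by (auto simp: diagonal_algebra_def B intro: C.mv_laws(7))
  qed (auto simp: diagonal_algebra_def B laws)
  moreover have "smmv_algebra_axioms ?D"
    by unfold_locales (auto simp: diagonal_algebra_def mv_hom_def B)
  ultimately show ?thesis
    by (rule smmv_algebra.intro)
qed

lemma subdiagonal_in_own_type:
  fixes A :: "'a smmv_structure"
  assumes "subdiagonal TYPE('c) A"
  shows "subdiagonal TYPE('a) A"
proof -
  obtain B C S h where A: "smmv_algebra A" and C: "mv_chain (C :: 'c mv_structure)"
    and B: "mv_subuniverse B C"
    and S: "smmv_subuniverse S (diagonal_algebra B C)"
    and h: "h \<in> smmv_iso A ((diagonal_algebra B C)\<lparr>carrier := S\<rparr>)"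
    using assms unfolding subdiagonal_def diagonal_def by blast
  define C1 where "C1 = C\<lparr>carrier := snd ` S\<rparr>"
  have SD: "S \<subseteq> B \<times> carrier C" "(\<zero>\<^bsub>C\<^esub>, \<zero>\<^bsub>C\<^esub>) \<in> S"
    "\<And>b c b' c'. (b, c) \<in> S \<Longrightarrow> (b', c') \<in> S \<Longrightarrow> (b \<oplus>\<^bsub>C\<^esub> b', c \<oplus>\<^bsub>C\<^esub> c') \<in> S"
    "\<And>b c. (b, c) \<in> S \<Longrightarrow> (\<sim>\<^bsub>C\<^esub> b, \<sim>\<^bsub>C\<^esub> c) \<in> S"
    "\<And>b c. (b, c) \<in> S \<Longrightarrow> (b, b) \<in> S"
    using S by (fastforce simp: smmv_subuniverse_def mv_subuniverse_def diagonal_algebra_def)+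
  have "mv_subuniverse (snd ` S) C"
    unfolding mv_subuniverse_def
  proof (intro conjI ballI)
    show "snd ` S \<subseteq> carrier C"
      using SD(1) by auto
    show "\<zero>\<^bsub>C\<^esub> \<in> snd ` S"
      using SD(2) by (rule rev_image_eqI) simp
    show "x \<oplus>\<^bsub>C\<^esub> y \<in> snd ` S" if "x \<in> snd ` S" "y \<in> snd ` S" for x y
      using that by (auto intro: rev_image_eqI[OF SD(3)])
    show "\<sim>\<^bsub>C\<^esub> x \<in> snd ` S" if "x \<in> snd ` S" for x
      using that by (auto intro: rev_image_eqI[OF SD(4)])
  qed
  then have C1: "mv_chain C1"
    unfolding C1_def by (rule mv_chain_subuniverse[OF C])
  have h_bij: "bij_betw h (carrier A) S" and
    h_hom: "\<And>x y. x \<in> carrier A \<Longrightarrow> y \<in> carrier A \<Longrightarrow>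
        h (x \<oplus>\<^bsub>A\<^esub> y) = (fst (h x) \<oplus>\<^bsub>C\<^esub> fst (h y), snd (h x) \<oplus>\<^bsub>C\<^esub> snd (h y))"
      "\<And>x. x \<in> carrier A \<Longrightarrow> h (\<sim>\<^bsub>A\<^esub> x) = (\<sim>\<^bsub>C\<^esub> (fst (h x)), \<sim>\<^bsub>C\<^esub> (snd (h x)))"
      "h \<zero>\<^bsub>A\<^esub> = (\<zero>\<^bsub>C\<^esub>, \<zero>\<^bsub>C\<^esub>)"
      "\<And>x. x \<in> carrier A \<Longrightarrow> h (\<tau>\<^bsub>A\<^esub> x) = (fst (h x), fst (h x))"
    using h by (auto simp: smmv_iso_def mv_hom_def diagonal_algebra_def case_prod_beta)
  define k where "k = snd \<circ> h"
  define g where "g = inv_into (carrier A) k"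
  have k_img: "k ` carrier A = carrier C1"
    using h_bij by (auto simp: k_def C1_def bij_betw_def)
  have kg: "k (g c) = c" if "c \<in> carrier C1" for c
    using that unfolding g_def k_img[symmetric] by (rule f_inv_into_f)
  define T where "T = \<lparr>carrier = g ` carrier C1, mv_add = (\<lambda>x y. g (k x \<oplus>\<^bsub>C1\<^esub> k y)),
    mv_neg = (\<lambda>x. g (\<sim>\<^bsub>C1\<^esub> (k x))), mv_zero = g \<zero>\<^bsub>C1\<^esub>\<rparr>"
  have T: "mv_chain T"
    unfolding T_def by (rule mv_chain_transport[OF C1, of k g, OF kg])
  define BT where "BT = g ` fst ` S"
  have fst_snd: "fst ` S \<subseteq> snd ` S"
    using SD(5) by force
  have kg1: "k (g (fst p)) = fst p" "k (g (snd p)) = snd p" if "p \<in> S" for p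
    using that fst_snd kg by (auto simp: C1_def)
  have kg2: "k (g b) = b" "k (g c) = c" if "(b, c) \<in> S" for b c
    using kg1[OF that] by auto
  have BT: "mv_subuniverse BT T"
    unfolding mv_subuniverse_def
  proof (intro conjI ballI)
    show "BT \<subseteq> carrier T"
      using fst_snd by (auto simp: BT_def T_def C1_def)
    show "\<zero>\<^bsub>T\<^esub> \<in> BT"
      using SD(2) by (force simp: BT_def T_def C1_def)
    show "x \<oplus>\<^bsub>T\<^esub> y \<in> BT" if "x \<in> BT" "y \<in> BT" for x y
    proof -
      obtain b c b' c' where "(b, c) \<in> S" "(b', c') \<in> S" "x = g b" "y = g b'"
        using \<open>x \<in> BT\<close> \<open>y \<in> BT\<close> by (auto simp: BT_def)
      then show ?thesis
        using SD(3)[of b c b' c'] by (force simp: BT_def T_def C1_def kg2)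
    qed
    show "\<sim>\<^bsub>T\<^esub> x \<in> BT" if "x \<in> BT" for x
    proof -
      obtain b c where "(b, c) \<in> S" "x = g b"
        using \<open>x \<in> BT\<close> by (auto simp: BT_def)
      then show ?thesis
        using SD(4)[of b c] by (force simp: BT_def T_def C1_def kg2)
    qed
  qed
  define D where "D = diagonal_algebra BT T"
  have D: "diagonal D"
    unfolding diagonal_def D_def using T BT mv_chain_subuniverse[OF T BT] by blast
  define S' where "S' = map_prod g g ` S"
  have "smmv_subuniverse S' D"
    unfolding smmv_subuniverse_def mv_subuniverse_def
  proof (intro conjI ballI)
    show "S' \<subseteq> carrier D"
      by (force simp: S'_def D_def diagonal_algebra_def BT_def T_def C1_def)
    show "\<zero>\<^bsub>D\<^esub> \<in> S'"
      using SD(2) by (force simp: S'_def D_def diagonal_algebra_def T_def C1_def)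
    show "x \<oplus>\<^bsub>D\<^esub> y \<in> S'" if "x \<in> S'" "y \<in> S'" for x y
    proof -
      obtain b c b' c' where "(b, c) \<in> S" "(b', c') \<in> S" "x = (g b, g c)" "y = (g b', g c')"
        using \<open>x \<in> S'\<close> \<open>y \<in> S'\<close> by (auto simp: S'_def)
      then show ?thesis
        using SD(3)[of b c b' c']
        by (force simp: S'_def D_def diagonal_algebra_def T_def C1_def kg2)
    qed
    fix x assume "x \<in> S'"
    then obtain b c where bc: "(b, c) \<in> S" "x = (g b, g c)"
      by (auto simp: S'_def)
    show "\<sim>\<^bsub>D\<^esub> x \<in> S'"
      using SD(4)[of b c] bc by (force simp: S'_def D_def diagonal_algebra_def T_def C1_def kg2)
    show "\<tau>\<^bsub>D\<^esub> x \<in> S'"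
      using SD(5)[of b c] bc by (force simp: S'_def D_def diagonal_algebra_def)
  qed
  moreover have "map_prod g g \<circ> h \<in> smmv_iso A (D\<lparr>carrier := S'\<rparr>)"
  proof -
    have hS: "h x \<in> S" if "x \<in> carrier A" for x
      using h_bij that by (auto simp: bij_betw_def)
    have "inj_on (map_prod g g) S"
      by (rule inj_onI) (metis kg1 fst_map_prod snd_map_prod prod_eq_iff)
    then have "bij_betw (map_prod g g) S S'"
      by (simp add: bij_betw_def S'_def)
    then have "bij_betw (map_prod g g \<circ> h) (carrier A) S'"
      using h_bij by (rule bij_betw_trans[rotated])
    then show ?thesis
      using hS by (auto simp: smmv_iso_def mv_hom_def S'_def D_def diagonal_algebra_def
          T_def C1_def h_hom kg1 case_prod_beta)
  qed
  ultimately show ?thesis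
    using A D unfolding subdiagonal_def by blast
qed

end

theory Submission
  imports Defs
begin

text \<open>
  By the correspondence between ideals and congruences, a subdirectly irreducible SMMV-algebra
  \<open>A\<close> has an element \<open>m \<noteq> \<zero>\<close> that lies in every nonzero ideal closed under \<open>\<tau>\<close>
  (\<open>monolith_element_exists\<close>). The ideal generated by \<open>x\<close> is closed under \<open>\<tau>\<close> as soon as
  \<open>\<tau> x \<preceq> x\<close>, so every \<open>x \<noteq> \<zero>\<close> with \<open>\<tau> x \<preceq> x\<close> generates \<open>m\<close>. The elements with
  \<open>\<tau> x \<preceq> x\<close> include the image of \<open>\<tau>\<close>, where \<open>\<tau> x = x\<close>, and its kernel, where \<open>\<tau> x = \<zero>\<close>.

  Let \<open>P\<close> be the polar of \<open>m\<close>, the ideal of all elements disjoint from \<open>m\<close>. It contains no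
  \<open>x \<noteq> \<zero>\<close> with \<open>\<tau> x \<preceq> x\<close>, since with \<open>x\<close> also \<open>m\<close> would be disjoint from \<open>m\<close>
  (\<open>monolith_polar_trivial\<close>). Moreover \<open>P\<close> is prime (\<open>monolith_polar_prime\<close>). To see this, note
  first that \<open>\<tau> u \<preceq> u\<close> for all \<open>u \<preceq> m\<close>: if the kernel of \<open>\<tau>\<close> is nonzero then it contains
  \<open>m\<close>, and otherwise \<open>\<tau>\<close> is the identity. If neither of the disjoint elements
  \<open>x \<ominus> y\<close> and \<open>y \<ominus> x\<close> were in \<open>P\<close>, there would be disjoint nonzero \<open>u, v \<preceq> m\<close>; as \<open>u\<close>
  generates \<open>m\<close>, also \<open>m\<close> is disjoint from \<open>v\<close>, that is, \<open>v \<in> P\<close>, which is impossible.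

  So \<open>C = A / P\<close> is a chain. Let \<open>r\<close> be the projection and \<open>B = r (\<tau> A)\<close>. The map
  \<open>a \<mapsto> (r (\<tau> a), r a)\<close> is a homomorphism into the diagonal algebra of \<open>B\<close> and \<open>C\<close>. It is
  injective because \<open>P\<close> meets the image and the kernel of \<open>\<tau>\<close> only in \<open>\<zero>\<close>: the first
  component determines \<open>\<tau> a\<close>, and the second determines \<open>a\<close> among the elements with the same
  \<open>\<tau> a\<close> (\<open>prime_ideal_imp_subdiagonal\<close>).
\<close>

section \<open>Basic notions\<close>

text \<open>This is the truncated difference: \<open>x \<ominus> y\<close> is the least \<open>z\<close> with \<open>x \<preceq> y \<oplus> z\<close>.\<close>

definition mv_diff :: "('a, 'm) mv_structure_scheme \<Rightarrow> 'a \<Rightarrow> 'a \<Rightarrow> 'a" (infixl \<open>\<ominus>\<index>\<close> 65)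
  where "x \<ominus>\<^bsub>A\<^esub> y = \<sim>\<^bsub>A\<^esub> ((\<sim>\<^bsub>A\<^esub> x) \<oplus>\<^bsub>A\<^esub> y)"

definition mv_ideal :: "'a set \<Rightarrow> ('a, 'm) mv_structure_scheme \<Rightarrow> bool"
  where "mv_ideal I A \<longleftrightarrow> I \<subseteq> carrier A \<and> \<zero>\<^bsub>A\<^esub> \<in> I \<and>
    (\<forall>x\<in>I. \<forall>y\<in>I. x \<oplus>\<^bsub>A\<^esub> y \<in> I) \<and>
    (\<forall>x\<in>carrier A. \<forall>y\<in>I. x \<preceq>\<^sub>M\<^bsub>A\<^esub> y \<longrightarrow> x \<in> I)"

definition ideal_rel :: "('a, 'm) mv_structure_scheme \<Rightarrow> 'a set \<Rightarrow> ('a \<times> 'a) set"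
  where "ideal_rel A I = {(x, y). x \<in> carrier A \<and> y \<in> carrier A \<and>
    x \<ominus>\<^bsub>A\<^esub> y \<in> I \<and> y \<ominus>\<^bsub>A\<^esub> x \<in> I}"

definition tau_ideal :: "'a set \<Rightarrow> ('a, 'm) smmv_structure_scheme \<Rightarrow> bool"
  where "tau_ideal I A \<longleftrightarrow> mv_ideal I A \<and> (\<forall>x\<in>I. \<tau>\<^bsub>A\<^esub> x \<in> I)"

text \<open>Such an element plays the part of the monolith: in a subdirectly irreducible algebra the
  difference of any two distinct elements related by the monolith will do, in one of the two
  orders.\<close>

definition monolith_element :: "('a, 'm) smmv_structure_scheme \<Rightarrow> 'a \<Rightarrow> bool"
  where "monolith_element A m \<longleftrightarrow> m \<in> carrier A \<and> m \<noteq> \<zero>\<^bsub>A\<^esub> \<and>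
    (\<forall>I. tau_ideal I A \<longrightarrow> I \<noteq> {\<zero>\<^bsub>A\<^esub>} \<longrightarrow> m \<in> I)"

definition generated_ideal :: "('a, 'm) mv_structure_scheme \<Rightarrow> 'a \<Rightarrow> 'a set"
  where "generated_ideal A x = \<Inter>{I. mv_ideal I A \<and> x \<in> I}"

text \<open>Two elements are disjoint if their meet is \<open>\<zero>\<close>. Saying that \<open>\<zero>\<close> is their only common
  lower bound spares the term for the meet.\<close>

definition mv_polar :: "('a, 'm) mv_structure_scheme \<Rightarrow> 'a \<Rightarrow> 'a set"
  where "mv_polar A m = {x \<in> carrier A.
    \<forall>z\<in>carrier A. z \<preceq>\<^sub>M\<^bsub>A\<^esub> x \<longrightarrow> z \<preceq>\<^sub>M\<^bsub>A\<^esub> m \<longrightarrow> z = \<zero>\<^bsub>A\<^esub>}"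

section \<open>Order and truncated difference\<close>

context mv_algebra
begin

lemmas mv_closed [simp] = mv_laws(1,2) neg_closed

lemma diff_closed [simp]: "x \<in> carrier A \<Longrightarrow> y \<in> carrier A \<Longrightarrow> x \<ominus> y \<in> carrier A"
  by (simp add: mv_diff_def)

lemma add_left_comm:
  assumes "x \<in> carrier A" "y \<in> carrier A" "z \<in> carrier A"
  shows "x \<oplus> (y \<oplus> z) = y \<oplus> (x \<oplus> z)"
  using assms mv_laws(4)[of x y] by (simp flip: mv_laws(3))

lemmas add_ac = mv_laws(3,4) add_left_comm

lemma add_zero: "x \<in> carrier A \<Longrightarrow> x \<oplus> \<zero> = x"
  using mv_laws(4)[of x \<zero>] by (simp add: mv_laws(5))

lemma top_add: "x \<in> carrier A \<Longrightarrow> \<sim> \<zero> \<oplus> x = \<sim> \<zero>"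
  using mv_laws(4)[of x "\<sim> \<zero>"] by (simp add: mv_laws(6))

lemma le_iff: "x \<preceq>\<^sub>M y \<longleftrightarrow> \<sim> x \<oplus> y = \<sim> \<zero>"
  by (simp add: mv_le_def mv_imp_def mv_one_def)

lemma neg_add_self: "x \<in> carrier A \<Longrightarrow> \<sim> x \<oplus> x = \<sim> \<zero>"
  using mv_laws(7)[of x "\<sim> \<zero>"] by (simp add: mv_laws(5,6) neg_neg)

lemma le_refl: "x \<in> carrier A \<Longrightarrow> x \<preceq>\<^sub>M x"
  by (simp add: le_iff neg_add_self)

lemma le_antisym: "x \<in> carrier A \<Longrightarrow> y \<in> carrier A \<Longrightarrow> x \<preceq>\<^sub>M y \<Longrightarrow> y \<preceq>\<^sub>M x \<Longrightarrow> x = y"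
  using mv_laws(7)[of x y] by (simp add: le_iff neg_neg mv_laws(5))

lemma le_add: "x \<in> carrier A \<Longrightarrow> y \<in> carrier A \<Longrightarrow> x \<preceq>\<^sub>M x \<oplus> y"
  by (simp add: le_iff neg_add_self top_add flip: mv_laws(3))

lemma le_add': "x \<in> carrier A \<Longrightarrow> y \<in> carrier A \<Longrightarrow> x \<preceq>\<^sub>M y \<oplus> x"
  using le_add[of x y] by (simp add: mv_laws(4))

lemma le_imp_add:
  assumes "x \<in> carrier A" "y \<in> carrier A" "x \<preceq>\<^sub>M y"
  shows "y \<ominus> x \<oplus> x = y"
  using mv_laws(7)[OF assms(1,2)] assms by (simp add: le_iff mv_diff_def neg_neg mv_laws(5))

lemma le_trans:
  assumes "x \<in> carrier A" "y \<in> carrier A" "z \<in> carrier A" "x \<preceq>\<^sub>M y" "y \<preceq>\<^sub>M z"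
  shows "x \<preceq>\<^sub>M z"
proof -
  have "z = (z \<ominus> y \<oplus> (y \<ominus> x)) \<oplus> x"
    using assms by (simp add: mv_laws(3) le_imp_add)
  then show ?thesis
    using assms le_add'[of x "z \<ominus> y \<oplus> (y \<ominus> x)"] by simp
qed

lemma zero_le: "x \<in> carrier A \<Longrightarrow> \<zero> \<preceq>\<^sub>M x"
  by (simp add: le_iff top_add)

lemma le_zero: "x \<in> carrier A \<Longrightarrow> x \<preceq>\<^sub>M \<zero> \<longleftrightarrow> x = \<zero>"
  by (auto simp: le_refl zero_le intro: le_antisym)

lemma diff_le_iff:
  assumes "x \<in> carrier A" "y \<in> carrier A" "z \<in> carrier A"
  shows "x \<ominus> y \<preceq>\<^sub>M z \<longleftrightarrow> x \<preceq>\<^sub>M y \<oplus> z"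
  using assms by (simp add: le_iff mv_diff_def neg_neg mv_laws(3))

lemma diff_eq_zero_iff: "x \<in> carrier A \<Longrightarrow> y \<in> carrier A \<Longrightarrow> x \<ominus> y = \<zero> \<longleftrightarrow> x \<preceq>\<^sub>M y"
  using diff_le_iff[of x y \<zero>] by (simp add: le_zero add_zero)

lemma diff_self: "x \<in> carrier A \<Longrightarrow> x \<ominus> x = \<zero>"
  by (simp add: diff_eq_zero_iff le_refl)

lemma zero_diff: "x \<in> carrier A \<Longrightarrow> \<zero> \<ominus> x = \<zero>"
  by (simp add: diff_eq_zero_iff zero_le)

lemma diff_zero: "x \<in> carrier A \<Longrightarrow> x \<ominus> \<zero> = x"
  by (simp add: mv_diff_def add_zero neg_neg)

lemma diff_neg_neg: "x \<in> carrier A \<Longrightarrow> y \<in> carrier A \<Longrightarrow> \<sim> x \<ominus> \<sim> y = y \<ominus> x"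
  by (simp add: mv_diff_def neg_neg mv_laws(4))

lemma diff_le: "x \<in> carrier A \<Longrightarrow> y \<in> carrier A \<Longrightarrow> x \<ominus> y \<preceq>\<^sub>M x"
  by (simp add: diff_le_iff le_add')

lemma add_mono:
  assumes "x \<in> carrier A" "y \<in> carrier A" "u \<in> carrier A" "v \<in> carrier A"
    and "x \<preceq>\<^sub>M y" "u \<preceq>\<^sub>M v"
  shows "x \<oplus> u \<preceq>\<^sub>M y \<oplus> v"
proof -
  have "x \<oplus> u \<oplus> (y \<ominus> x \<oplus> (v \<ominus> u)) = (y \<ominus> x \<oplus> x) \<oplus> (v \<ominus> u \<oplus> u)"
    using assms(1-4) by (simp add: add_ac)
  also have "\<dots> = y \<oplus> v"
    using assms by (simp add: le_imp_add)
  finally show ?thesis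
    using assms le_add[of "x \<oplus> u" "y \<ominus> x \<oplus> (v \<ominus> u)"] by simp
qed

lemma diff_triangle:
  assumes "x \<in> carrier A" "y \<in> carrier A" "z \<in> carrier A"
  shows "x \<ominus> z \<preceq>\<^sub>M (x \<ominus> y) \<oplus> (y \<ominus> z)"
proof -
  have "x \<preceq>\<^sub>M y \<oplus> (x \<ominus> y)" "y \<preceq>\<^sub>M z \<oplus> (y \<ominus> z)"
    using assms by (simp_all add: le_refl flip: diff_le_iff)
  then have "x \<preceq>\<^sub>M (z \<oplus> (y \<ominus> z)) \<oplus> (x \<ominus> y)"
    using assms le_trans[of x "y \<oplus> (x \<ominus> y)" "z \<oplus> (y \<ominus> z) \<oplus> (x \<ominus> y)"]
    by (simp add: add_mono le_refl)
  then show ?thesis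
    using assms by (simp add: diff_le_iff mv_laws(3) mv_laws(4)[of "x \<ominus> y"])
qed

lemma diff_add_le:
  assumes "x \<in> carrier A" "y \<in> carrier A" "u \<in> carrier A" "v \<in> carrier A"
  shows "(x \<oplus> u) \<ominus> (y \<oplus> v) \<preceq>\<^sub>M (x \<ominus> y) \<oplus> (u \<ominus> v)"
proof -
  have "x \<preceq>\<^sub>M y \<oplus> (x \<ominus> y)" "u \<preceq>\<^sub>M v \<oplus> (u \<ominus> v)"
    using assms by (simp_all add: le_refl flip: diff_le_iff)
  then have "x \<oplus> u \<preceq>\<^sub>M (y \<oplus> (x \<ominus> y)) \<oplus> (v \<oplus> (u \<ominus> v))"
    using assms by (simp add: add_mono)
  also have "(y \<oplus> (x \<ominus> y)) \<oplus> (v \<oplus> (u \<ominus> v)) = (y \<oplus> v) \<oplus> ((x \<ominus> y) \<oplus> (u \<ominus> v))"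
    using assms by (simp add: add_ac)
  finally show ?thesis
    using assms by (simp add: diff_le_iff)
qed

lemma diff_antimono:
  assumes "x \<in> carrier A" "y \<in> carrier A" "z \<in> carrier A" "y \<preceq>\<^sub>M z"
  shows "x \<ominus> z \<preceq>\<^sub>M x \<ominus> y"
proof -
  have "y \<ominus> z = \<zero>"
    using assms by (simp add: diff_eq_zero_iff)
  then show ?thesis
    using diff_triangle[OF assms(1,2,3)] assms by (simp add: add_zero)
qed

text \<open>Both sides are the meet of \<open>x\<close> and \<open>y\<close>; this is the De Morgan dual of the axiom
  \<open>imp_imp\<close>, whose two sides are the join.\<close>

lemma diff_diff_commute:
  assumes "x \<in> carrier A" "y \<in> carrier A"
  shows "x \<ominus> (x \<ominus> y) = y \<ominus> (y \<ominus> x)"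
  using assms mv_laws(7)[of "\<sim> x" "\<sim> y"] by (simp add: mv_diff_def neg_neg mv_laws(4))

text \<open>Addition is cancellative as long as it is not truncated: \<open>z \<preceq> \<sim> g\<close> says that \<open>g \<oplus> z\<close>
  has not been cut off at the top element. The axiom \<open>imp_imp\<close> turns this into
  \<open>\<sim> z = \<sim> (g \<oplus> z) \<oplus> g\<close>.\<close>

lemma add_absorb_imp_zero:
  assumes "g \<in> carrier A" "z \<in> carrier A" "z \<preceq>\<^sub>M \<sim> g" "g \<oplus> z \<preceq>\<^sub>M g"
  shows "z = \<zero>"
proof -
  have "g \<oplus> z = g"
    using assms by (intro le_antisym le_add) simp_all
  have "\<sim> z = \<sim> z \<ominus> g \<oplus> g"
    using assms le_imp_add[of g "\<sim> z"] by (simp add: le_iff neg_neg mv_laws(4))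
  also have "\<dots> = \<sim> (g \<oplus> z) \<oplus> g"
    using assms by (simp add: mv_diff_def neg_neg mv_laws(4)[of z g])
  also have "\<dots> = \<sim> \<zero>"
    using assms by (simp add: \<open>g \<oplus> z = g\<close> neg_add_self)
  finally have "\<sim> (\<sim> z) = \<sim> (\<sim> \<zero>)"
    by simp
  then show ?thesis
    using assms by (simp add: neg_neg)
qed

text \<open>This is prelinearity. Let \<open>g\<close> be the meet of \<open>x\<close> and \<open>y\<close>. What lies below both differences
  can be added to \<open>g\<close> without leaving \<open>x\<close> or \<open>y\<close>, hence is absorbed by \<open>g\<close>, hence is \<open>\<zero>\<close>.\<close>

lemma diff_diff_disjoint:
  assumes "x \<in> carrier A" "y \<in> carrier A" "z \<in> carrier A"
    and "z \<preceq>\<^sub>M x \<ominus> y" "z \<preceq>\<^sub>M y \<ominus> x"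
  shows "z = \<zero>"
proof -
  define g where "g = x \<ominus> (x \<ominus> y)"
  have g: "g \<in> carrier A"
    using assms by (simp add: g_def)
  have sym: "g = y \<ominus> (y \<ominus> x)"
    unfolding g_def using assms(1,2) by (rule diff_diff_commute)
  have add_le: "(u \<ominus> (u \<ominus> v)) \<oplus> z \<preceq>\<^sub>M u"
    if "u \<in> carrier A" "v \<in> carrier A" "z \<preceq>\<^sub>M u \<ominus> v" for u v
  proof -
    have "z \<preceq>\<^sub>M u"
      using that assms(3) diff_le[of u v] le_trans[of z "u \<ominus> v" u] by simp
    moreover have "(u \<ominus> (u \<ominus> v)) \<oplus> z \<preceq>\<^sub>M u \<ominus> z \<oplus> z"
      using that assms(3) by (simp add: add_mono diff_antimono le_refl)
    ultimately show ?thesis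
      using that assms(3) by (simp add: le_imp_add)
  qed
  have "g \<oplus> z \<preceq>\<^sub>M x"
    using add_le[OF assms(1,2,4)] by (simp add: g_def)
  have "g \<oplus> z \<preceq>\<^sub>M y"
    using add_le[OF assms(2,1,5)] by (simp add: sym)
  \<comment> \<open>\<open>g\<close> is the greatest lower bound of \<open>x\<close> and \<open>y\<close>.\<close>
  have "g \<oplus> z \<preceq>\<^sub>M g"
  proof -
    let ?w = "g \<oplus> z"
    have w: "?w \<in> carrier A" using g assms by simp
    have "x \<ominus> (x \<ominus> ?w) = ?w \<ominus> (?w \<ominus> x)"
      using assms(1) w by (rule diff_diff_commute)
    also have "\<dots> = ?w"
      using assms(1) w \<open>?w \<preceq>\<^sub>M x\<close> diff_eq_zero_iff[of ?w x] diff_zero[of ?w] by simp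
    finally have "?w = x \<ominus> (x \<ominus> ?w)" ..
    moreover have "x \<ominus> y \<preceq>\<^sub>M x \<ominus> ?w"
      using assms w \<open>?w \<preceq>\<^sub>M y\<close> by (simp add: diff_antimono)
    ultimately show ?thesis
      using assms w diff_antimono[of x "x \<ominus> y" "x \<ominus> ?w"] by (simp add: g_def)
  qed
  moreover have "z \<preceq>\<^sub>M \<sim> g"
  proof -
    have "x \<ominus> y \<preceq>\<^sub>M \<sim> g"
      using assms by (simp add: g_def mv_diff_def neg_neg le_add')
    then show ?thesis
      using assms g le_trans[of z "x \<ominus> y" "\<sim> g"] by simp
  qed
  ultimately show ?thesis
    using add_absorb_imp_zero g assms(3) by blast
qed

section \<open>The congruence of an ideal\<close>

lemma ideal_add: "mv_ideal I A \<Longrightarrow> x \<in> I \<Longrightarrow> y \<in> I \<Longrightarrow> x \<oplus> y \<in> I"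
  by (simp add: mv_ideal_def)

lemma ideal_down: "mv_ideal I A \<Longrightarrow> y \<in> I \<Longrightarrow> x \<in> carrier A \<Longrightarrow> x \<preceq>\<^sub>M y \<Longrightarrow> x \<in> I"
  unfolding mv_ideal_def by blast

lemma ideal_rel_equiv:
  assumes "mv_ideal I A"
  shows "equiv (carrier A) (ideal_rel A I)"
proof (rule equivI)
  show "ideal_rel A I \<subseteq> carrier A \<times> carrier A"
    by (auto simp: ideal_rel_def)
  show "refl_on (carrier A) (ideal_rel A I)"
    using assms by (auto simp: refl_on_def ideal_rel_def mv_ideal_def diff_self)
  show "sym (ideal_rel A I)"
    by (auto simp: sym_def ideal_rel_def)
  show "trans (ideal_rel A I)"
  proof (rule transI)
    have "x \<ominus> z \<in> I" if "x \<in> carrier A" "y \<in> carrier A" "z \<in> carrier A"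
      "x \<ominus> y \<in> I" "y \<ominus> z \<in> I" for x y z
      using that by (intro ideal_down[OF assms ideal_add[OF assms that(4,5)]])
        (simp_all add: diff_triangle)
    then show "(x, z) \<in> ideal_rel A I"
      if "(x, y) \<in> ideal_rel A I" "(y, z) \<in> ideal_rel A I" for x y z
      using that unfolding ideal_rel_def by blast
  qed
qed

lemma ideal_rel_add:
  assumes "mv_ideal I A" "(x, x') \<in> ideal_rel A I" "(y, y') \<in> ideal_rel A I"
  shows "(x \<oplus> y, x' \<oplus> y') \<in> ideal_rel A I"
proof -
  have "(x \<oplus> u) \<ominus> (y \<oplus> v) \<in> I" if "x \<in> carrier A" "y \<in> carrier A" "u \<in> carrier A"
    "v \<in> carrier A" "x \<ominus> y \<in> I" "u \<ominus> v \<in> I" for x y u v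
    using that by (intro ideal_down[OF assms(1) ideal_add[OF assms(1) that(5,6)]])
      (simp_all add: diff_add_le)
  then show ?thesis
    using assms(2,3) by (auto simp: ideal_rel_def)
qed

lemma ideal_rel_neg:
  assumes "(x, x') \<in> ideal_rel A I"
  shows "(\<sim> x, \<sim> x') \<in> ideal_rel A I"
  using assms by (auto simp: ideal_rel_def diff_neg_neg)

section \<open>Polars and generated ideals\<close>

text \<open>The only point is closure under addition: if \<open>z \<preceq> x \<oplus> y\<close> and \<open>z \<preceq> m\<close>, then
  \<open>z \<ominus> x\<close> lies below both \<open>y\<close> and \<open>m\<close>, so it vanishes; thus \<open>z \<preceq> x\<close>, and \<open>z\<close> vanishes too.\<close>

lemma polar_ideal: "m \<in> carrier A \<Longrightarrow> mv_ideal (mv_polar A m) A"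
  unfolding mv_ideal_def
proof (intro conjI ballI impI)
  assume m: "m \<in> carrier A"
  show "mv_polar A m \<subseteq> carrier A" "\<zero> \<in> mv_polar A m"
    by (auto simp: mv_polar_def le_zero)
  show "x \<in> mv_polar A m" if "x \<in> carrier A" "y \<in> mv_polar A m" "x \<preceq>\<^sub>M y" for x y
    using that le_trans unfolding mv_polar_def by blast
  fix x y assume xy: "x \<in> mv_polar A m" "y \<in> mv_polar A m"
  then have c: "x \<in> carrier A" "y \<in> carrier A"
    by (auto simp: mv_polar_def)
  have "z = \<zero>" if z: "z \<in> carrier A" "z \<preceq>\<^sub>M x \<oplus> y" "z \<preceq>\<^sub>M m" for z
  proof -
    have "z \<ominus> x \<preceq>\<^sub>M y" "z \<ominus> x \<preceq>\<^sub>M m"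
      using z c m le_trans[OF _ _ _ diff_le[of z x]] by (simp_all add: diff_le_iff)
    then have "z \<ominus> x = \<zero>"
      using xy z c by (auto simp: mv_polar_def)
    then show ?thesis
      using xy z c by (auto simp: mv_polar_def diff_eq_zero_iff)
  qed
  then show "x \<oplus> y \<in> mv_polar A m"
    using c by (auto simp: mv_polar_def)
qed

lemma polar_sym: "m \<in> carrier A \<Longrightarrow> x \<in> mv_polar A m \<Longrightarrow> m \<in> mv_polar A x"
  by (auto simp: mv_polar_def)

lemma self_in_polar: "m \<in> mv_polar A m \<Longrightarrow> m = \<zero>"
  by (auto simp: mv_polar_def le_refl)

lemma carrier_ideal: "mv_ideal (carrier A) A"
  by (auto simp: mv_ideal_def)

lemma generated_ideal_ideal:
  assumes "x \<in> carrier A"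
  shows "mv_ideal (generated_ideal A x) A"
proof -
  have "generated_ideal A x \<subseteq> carrier A"
    using assms carrier_ideal by (auto simp: generated_ideal_def)
  then show ?thesis
    unfolding mv_ideal_def
  proof (intro conjI ballI impI)
    show "\<zero> \<in> generated_ideal A x"
      by (auto simp: generated_ideal_def mv_ideal_def)
    show "u \<oplus> v \<in> generated_ideal A x"
      if "u \<in> generated_ideal A x" "v \<in> generated_ideal A x" for u v
      using that by (simp add: generated_ideal_def mv_ideal_def)
    show "u \<in> generated_ideal A x"
      if "u \<in> carrier A" "v \<in> generated_ideal A x" "u \<preceq>\<^sub>M v" for u v
      using that unfolding generated_ideal_def mv_ideal_def by blast
  qed
qed

lemma self_in_generated_ideal: "x \<in> generated_ideal A x"
  by (auto simp: generated_ideal_def)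

lemma generated_ideal_least: "mv_ideal I A \<Longrightarrow> x \<in> I \<Longrightarrow> generated_ideal A x \<subseteq> I"
  by (auto simp: generated_ideal_def)

end

section \<open>Homomorphisms and linear quotients\<close>

lemma mv_hom_diff:
  assumes "mv_algebra A" "h \<in> mv_hom A B" "x \<in> carrier A" "y \<in> carrier A"
  shows "h (x \<ominus>\<^bsub>A\<^esub> y) = h x \<ominus>\<^bsub>B\<^esub> h y"
proof -
  interpret mv_algebra A by fact
  show ?thesis
    using assms(2-4) by (simp add: mv_hom_def mv_diff_def)
qed

lemma mv_hom_mono:
  assumes "mv_algebra A" "h \<in> mv_hom A B" "x \<in> carrier A" "y \<in> carrier A" "x \<preceq>\<^sub>M\<^bsub>A\<^esub> y"
  shows "h x \<preceq>\<^sub>M\<^bsub>B\<^esub> h y"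
proof -
  interpret mv_algebra A by fact
  have "h (\<sim>\<^bsub>A\<^esub> x \<oplus>\<^bsub>A\<^esub> y) = h (\<sim>\<^bsub>A\<^esub> \<zero>\<^bsub>A\<^esub>)"
    using assms(5) by (simp add: le_iff)
  then show ?thesis
    using assms(2-4) by (simp add: mv_hom_def mv_le_def mv_imp_def mv_one_def)
qed

lemma mv_algebra_hom_image:
  assumes "mv_algebra A" "h \<in> mv_hom A C" "h ` carrier A = carrier C"
  shows "mv_algebra C"
proof -
  interpret mv_algebra A by fact
  have hom: "\<And>x y. x \<in> carrier A \<Longrightarrow> y \<in> carrier A \<Longrightarrow> h x \<oplus>\<^bsub>C\<^esub> h y = h (x \<oplus>\<^bsub>A\<^esub> y)"
    "\<And>x. x \<in> carrier A \<Longrightarrow> \<sim>\<^bsub>C\<^esub> (h x) = h (\<sim>\<^bsub>A\<^esub> x)" "\<zero>\<^bsub>C\<^esub> = h \<zero>\<^bsub>A\<^esub>"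
    using assms(2) by (auto simp: mv_hom_def)
  show ?thesis
  proof (rule mv_algebraI, unfold assms(3)[symmetric])
    show "x \<oplus>\<^bsub>C\<^esub> y = y \<oplus>\<^bsub>C\<^esub> x" if "x \<in> h ` carrier A" "y \<in> h ` carrier A" for x y
      using that by (auto simp: hom mv_laws(4))
    show "\<sim>\<^bsub>C\<^esub> (\<sim>\<^bsub>C\<^esub> x \<oplus>\<^bsub>C\<^esub> y) \<oplus>\<^bsub>C\<^esub> y = \<sim>\<^bsub>C\<^esub> (\<sim>\<^bsub>C\<^esub> y \<oplus>\<^bsub>C\<^esub> x) \<oplus>\<^bsub>C\<^esub> x"
      if xy: "x \<in> h ` carrier A" "y \<in> h ` carrier A" for x y
    proof -
      obtain a b where "a \<in> carrier A" "b \<in> carrier A" "x = h a" "y = h b"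
        using xy by blast
      then show ?thesis
        using mv_laws(7)[of a b] by (simp add: hom)
    qed
  qed (auto simp: hom mv_laws(3,5,6) neg_neg)
qed

text \<open>The quotient is realised on chosen representatives of the classes, with \<open>r\<close> sending each
  element to its representative, so that its elements have the same type as those of \<open>A\<close>.
  Primality makes it linear because \<open>x \<ominus> y \<in> I\<close> says that the class of \<open>x\<close> is below that
  of \<open>y\<close>.\<close>

lemma (in mv_algebra) quotient_chain_exists:
  assumes I: "mv_ideal I A"
    and prime: "\<forall>x\<in>carrier A. \<forall>y\<in>carrier A. x \<ominus> y \<in> I \<or> y \<ominus> x \<in> I"
  shows "\<exists>(C :: 'a mv_structure) r. mv_chain C \<and> r \<in> mv_hom A C \<and> r ` carrier A = carrier C \<and>
    (\<forall>x\<in>carrier A. \<forall>y\<in>carrier A. r x = r y \<longrightarrow> (x, y) \<in> ideal_rel A I)"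
proof -
  let ?R = "ideal_rel A I"
  note eq = ideal_rel_equiv[OF I]
  define r where "r x = (SOME y. (x, y) \<in> ?R)" for x
  have r: "(x, r x) \<in> ?R" if "x \<in> carrier A" for x
  proof -
    have "(x, x) \<in> ?R"
      using eq that by (simp add: equiv_def refl_on_def)
    then show ?thesis
      unfolding r_def by (rule someI[of "\<lambda>y. (x, y) \<in> ?R"])
  qed
  have r_eq: "r x = r y" if "(x, y) \<in> ?R" for x y
  proof -
    have "(x, z) \<in> ?R \<longleftrightarrow> (y, z) \<in> ?R" for z
      using eq that unfolding equiv_def sym_def trans_def by blast
    then show ?thesis
      by (simp add: r_def)
  qed
  define C :: "'a mv_structure" where "C = \<lparr>carrier = r ` carrier A, mv_add = (\<lambda>x y. r (x \<oplus> y)),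
    mv_neg = (\<lambda>x. r (\<sim> x)), mv_zero = r \<zero>\<rparr>"
  have hom: "r \<in> mv_hom A C"
    unfolding mv_hom_def C_def using r
    by (auto intro!: r_eq ideal_rel_add[OF I] ideal_rel_neg)
  have onto: "r ` carrier A = carrier C"
    by (simp add: C_def)
  have ker: "(x, y) \<in> ?R" if "x \<in> carrier A" "y \<in> carrier A" "r x = r y" for x y
    using r[OF that(1)] r[OF that(2)] that(3) eq unfolding equiv_def sym_def trans_def by metis
  interpret C: mv_algebra C
    using mv_algebra_hom_image[OF _ hom onto] mv_algebra_axioms by blast
  have le: "r x \<preceq>\<^sub>M\<^bsub>C\<^esub> r y" if "x \<in> carrier A" "y \<in> carrier A" "x \<ominus> y \<in> I" for x y
  proof -
    have "(x \<ominus> y, \<zero>) \<in> ?R"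
      using that I by (simp add: ideal_rel_def mv_ideal_def diff_zero zero_diff)
    then have "r x \<ominus>\<^bsub>C\<^esub> r y = \<zero>\<^bsub>C\<^esub>"
      using r_eq mv_hom_diff[OF mv_algebra_axioms hom that(1,2)] hom by (simp add: mv_hom_def)
    then show ?thesis
      using that onto C.diff_eq_zero_iff by blast
  qed
  have "mv_chain C"
  proof
    fix x y assume "x \<in> carrier C" "y \<in> carrier C"
    then show "x \<preceq>\<^sub>M\<^bsub>C\<^esub> y \<or> y \<preceq>\<^sub>M\<^bsub>C\<^esub> x"
      using le prime unfolding onto[symmetric] by blast
  qed
  then show ?thesis
    using hom onto ker by blast
qed

section \<open>Subdirectly irreducible SMMV-algebras\<close>

context smmv_algebra
begin

lemma tau_closed [simp]: "x \<in> carrier A \<Longrightarrow> \<tau> x \<in> carrier A"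
  and tau_add: "x \<in> carrier A \<Longrightarrow> y \<in> carrier A \<Longrightarrow> \<tau> (x \<oplus> y) = \<tau> x \<oplus> \<tau> y"
  and tau_neg: "x \<in> carrier A \<Longrightarrow> \<tau> (\<sim> x) = \<sim> (\<tau> x)"
  and tau_zero [simp]: "\<tau> \<zero> = \<zero>"
  using tau_endo by (auto simp: mv_hom_def)

lemmas tau_diff = mv_hom_diff[OF mv_algebra_axioms tau_endo]
  and tau_mono = mv_hom_mono[OF mv_algebra_axioms tau_endo]

lemma tau_vimage_ideal:
  assumes "mv_ideal I A"
  shows "mv_ideal {x \<in> carrier A. \<tau> x \<in> I} A"
  unfolding mv_ideal_def
proof (intro conjI ballI impI)
  show "\<zero> \<in> {x \<in> carrier A. \<tau> x \<in> I}"
    using assms by (simp add: mv_ideal_def)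
  show "x \<in> {x \<in> carrier A. \<tau> x \<in> I}"
    if "x \<in> carrier A" "y \<in> {x \<in> carrier A. \<tau> x \<in> I}" "x \<preceq>\<^sub>M y" for x y
    using that by (auto intro: ideal_down[OF assms _ _ tau_mono])
qed (auto simp: tau_add intro: ideal_add[OF assms])

lemma ideal_rel_smmv_congruence:
  assumes "tau_ideal I A"
  shows "smmv_congruence A (ideal_rel A I)"
proof -
  have I: "mv_ideal I A"
    using assms by (simp add: tau_ideal_def)
  have "(\<tau> x, \<tau> x') \<in> ideal_rel A I" if "(x, x') \<in> ideal_rel A I" for x x'
    using that assms by (auto simp: ideal_rel_def tau_ideal_def simp flip: tau_diff)
  then show ?thesis
    using ideal_rel_equiv[OF I] ideal_rel_add[OF I] ideal_rel_neg
    unfolding smmv_congruence_def by blast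
qed

lemma monolith_element_exists:
  assumes "subdirectly_irreducible A"
  shows "\<exists>m. monolith_element A m"
proof -
  obtain \<mu> where \<mu>: "smmv_congruence A \<mu>" "\<mu> \<noteq> Id_on (carrier A)"
    and least: "\<And>\<theta>. smmv_congruence A \<theta> \<Longrightarrow> \<theta> \<noteq> Id_on (carrier A) \<Longrightarrow> \<mu> \<subseteq> \<theta>"
    using assms unfolding subdirectly_irreducible_def by blast
  have eq: "equiv (carrier A) \<mu>"
    using \<mu>(1) by (simp add: smmv_congruence_def)
  then have "Id_on (carrier A) \<subseteq> \<mu>"
    by (auto simp: equiv_def refl_on_def)
  then obtain a b where ab: "(a, b) \<in> \<mu>" "(a, b) \<notin> Id_on (carrier A)"
    using \<mu>(2) by auto
  have c: "a \<in> carrier A" "b \<in> carrier A"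
    using eq ab(1) by (auto simp: equiv_def refl_on_def)
  have "a \<noteq> b"
    using ab c by auto
  then have "a \<ominus> b \<noteq> \<zero> \<or> b \<ominus> a \<noteq> \<zero>"
    using c diff_eq_zero_iff le_antisym by blast
  then obtain m where m: "m \<in> carrier A" "m \<noteq> \<zero>" "m = a \<ominus> b \<or> m = b \<ominus> a"
    using c diff_closed by blast
  have "m \<in> I" if I: "tau_ideal I A" "I \<noteq> {\<zero>}" for I
  proof -
    have I': "I \<subseteq> carrier A" "\<zero> \<in> I"
      using I(1) by (simp_all add: tau_ideal_def mv_ideal_def)
    then obtain x where x: "x \<in> I" "x \<noteq> \<zero>" "x \<in> carrier A"
      using I(2) by blast
    then have "(x, \<zero>) \<in> ideal_rel A I"
      using I' by (simp add: ideal_rel_def diff_zero zero_diff)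
    then have "ideal_rel A I \<noteq> Id_on (carrier A)"
      using x(2) by (auto simp: Id_on_iff)
    then have "\<mu> \<subseteq> ideal_rel A I"
      using least I(1) by (simp add: ideal_rel_smmv_congruence)
    then show ?thesis
      using m(3) ab(1) by (auto simp: ideal_rel_def)
  qed
  then show ?thesis
    using m(1,2) by (auto simp: monolith_element_def)
qed

text \<open>The preimage under \<open>\<tau>\<close> of the ideal generated by \<open>x\<close> is again an ideal, and it contains
  \<open>x\<close> because \<open>\<tau> x \<preceq> x\<close>; so it contains the generated ideal.\<close>

lemma generated_ideal_tau_ideal:
  assumes "x \<in> carrier A" "\<tau> x \<preceq>\<^sub>M x"
  shows "tau_ideal (generated_ideal A x) A"
proof -
  let ?J = "generated_ideal A x"
  have J: "mv_ideal ?J A"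
    using assms(1) by (rule generated_ideal_ideal)
  have "\<tau> x \<in> ?J"
    using assms(1,2) by (intro ideal_down[OF J self_in_generated_ideal]) simp_all
  then have "?J \<subseteq> {x \<in> carrier A. \<tau> x \<in> ?J}"
    using assms(1) J by (intro generated_ideal_least tau_vimage_ideal) auto
  then show ?thesis
    using J by (auto simp: tau_ideal_def)
qed

text \<open>The kernel of \<open>\<tau>\<close> is an ideal closed under \<open>\<tau>\<close>. If it is nonzero it contains \<open>m\<close>, and
  then \<open>\<tau>\<close> vanishes below \<open>m\<close>. If it is zero, \<open>\<tau>\<close> is injective and idempotent, hence the
  identity; the inequality follows from \<open>\<tau> x \<ominus> x\<close> being in the kernel.\<close>

lemma tau_le_below_monolith_element:
  assumes m: "monolith_element A m"
    and x: "x \<in> carrier A" "x \<preceq>\<^sub>M m"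
  shows "\<tau> x \<preceq>\<^sub>M x"
proof (cases "{x \<in> carrier A. \<tau> x = \<zero>} = {\<zero>}")
  case True
  have "\<tau> (\<tau> x \<ominus> x) = \<zero>"
    using x by (simp add: tau_diff tau_idem diff_self)
  then have "\<tau> x \<ominus> x = \<zero>"
    using True x(1) diff_closed[of "\<tau> x" x] tau_closed by blast
  then show ?thesis
    using x(1) by (simp add: diff_eq_zero_iff)
next
  case False
  have "mv_ideal {x \<in> carrier A. \<tau> x \<in> {\<zero>}} A"
    by (rule tau_vimage_ideal) (auto simp: mv_ideal_def le_zero mv_laws(5))
  then have "tau_ideal {x \<in> carrier A. \<tau> x = \<zero>} A"
    by (simp add: tau_ideal_def)
  then have "m \<in> {x \<in> carrier A. \<tau> x = \<zero>}"
    using m False unfolding monolith_element_def by blast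
  then show ?thesis
    using tau_mono[of x m] x by (simp add: le_zero zero_le)
qed

text \<open>The polar of \<open>y\<close>, being an ideal, contains the whole ideal generated by \<open>x\<close>, and that ideal
  contains \<open>m\<close>.\<close>

lemma monolith_element_transfer:
  assumes m: "monolith_element A m"
    and x: "x \<in> mv_polar A y" "x \<noteq> \<zero>" "\<tau> x \<preceq>\<^sub>M x" and y: "y \<in> carrier A"
  shows "m \<in> mv_polar A y"
proof -
  have xc: "x \<in> carrier A"
    using x(1) by (simp add: mv_polar_def)
  have "generated_ideal A x \<noteq> {\<zero>}"
    using self_in_generated_ideal[of x] x(2) by auto
  then have "m \<in> generated_ideal A x"
    using m generated_ideal_tau_ideal[OF xc x(3)] by (simp add: monolith_element_def)
  then show ?thesis
    using generated_ideal_least[OF polar_ideal[OF y] x(1)] by blast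
qed

lemma monolith_polar_trivial:
  assumes m: "monolith_element A m"
    and x: "x \<in> mv_polar A m" "\<tau> x \<preceq>\<^sub>M x"
  shows "x = \<zero>"
proof (rule ccontr)
  assume "x \<noteq> \<zero>"
  have "m \<in> mv_polar A m"
    using monolith_element_transfer[OF m x(1) \<open>x \<noteq> \<zero>\<close> x(2)] m
    by (simp add: monolith_element_def)
  then show False
    using self_in_polar m by (auto simp: monolith_element_def)
qed

text \<open>The polar of \<open>m\<close> is prime because \<open>m\<close> has no two disjoint nonzero elements below it.\<close>

lemma monolith_polar_prime:
  assumes m: "monolith_element A m"
    and xy: "x \<in> carrier A" "y \<in> carrier A"
  shows "x \<ominus> y \<in> mv_polar A m \<or> y \<ominus> x \<in> mv_polar A m"
proof (rule ccontr)
  assume "\<not> ?thesis"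
  then obtain u v where u: "u \<in> carrier A" "u \<preceq>\<^sub>M x \<ominus> y" "u \<preceq>\<^sub>M m" "u \<noteq> \<zero>"
    and v: "v \<in> carrier A" "v \<preceq>\<^sub>M y \<ominus> x" "v \<preceq>\<^sub>M m" "v \<noteq> \<zero>"
    using xy by (auto simp: mv_polar_def)
  have tau: "\<tau> u \<preceq>\<^sub>M u" "\<tau> v \<preceq>\<^sub>M v"
    by (rule tau_le_below_monolith_element[OF m u(1,3)])
      (rule tau_le_below_monolith_element[OF m v(1,3)])
  have "z = \<zero>" if "z \<in> carrier A" "z \<preceq>\<^sub>M u" "z \<preceq>\<^sub>M v" for z
    using that xy u v diff_diff_disjoint[of x y z] le_trans[of z u "x \<ominus> y"]
      le_trans[of z v "y \<ominus> x"] by simp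
  then have "u \<in> mv_polar A v"
    using u(1) by (simp add: mv_polar_def)
  \<comment> \<open>Disjointness from \<open>v\<close> passes from \<open>u\<close> to \<open>m\<close>, and by symmetry \<open>v\<close> is in the polar of \<open>m\<close>.\<close>
  then have "m \<in> mv_polar A v"
    by (rule monolith_element_transfer[OF m _ u(4) tau(1) v(1)])
  then have "v \<in> mv_polar A m"
    by (rule polar_sym[OF v(1)])
  then have "v = \<zero>"
    by (rule monolith_polar_trivial[OF m _ tau(2)])
  then show False
    using v(4) by contradiction
qed

end

section \<open>Embedding into a diagonal algebra\<close>

text \<open>The last hypothesis is applied to differences in the image of \<open>\<tau>\<close> and to differences in
  its kernel. The former make \<open>r\<close> injective on the image of \<open>\<tau>\<close>, the latter make it injective
  on each fibre of \<open>\<tau>\<close>, and together they give that \<open>a \<mapsto> (r (\<tau> a), r a)\<close> is injective.\<close>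

lemma prime_ideal_imp_subdiagonal:
  fixes A :: "'a smmv_structure" (structure)
  assumes A: "smmv_algebra A"
    and P: "mv_ideal P A"
    and prime: "\<forall>x\<in>carrier A. \<forall>y\<in>carrier A. x \<ominus> y \<in> P \<or> y \<ominus> x \<in> P"
    and P_zero: "\<forall>x\<in>P. \<tau> x \<preceq>\<^sub>M x \<longrightarrow> x = \<zero>"
  shows "subdiagonal TYPE('a) A"
proof -
  interpret smmv_algebra A by fact
  obtain C :: "'a mv_structure" and r where C: "mv_chain C" and r: "r \<in> mv_hom A C"
    and onto: "r ` carrier A = carrier C"
    and ker: "\<forall>x\<in>carrier A. \<forall>y\<in>carrier A. r x = r y \<longrightarrow> (x, y) \<in> ideal_rel A P"
    using quotient_chain_exists[OF P prime] by blast
  have hom: "\<And>x y. x \<in> carrier A \<Longrightarrow> y \<in> carrier A \<Longrightarrow> r x \<oplus>\<^bsub>C\<^esub> r y = r (x \<oplus> y)"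
    "\<And>x. x \<in> carrier A \<Longrightarrow> \<sim>\<^bsub>C\<^esub> (r x) = r (\<sim> x)" "\<zero>\<^bsub>C\<^esub> = r \<zero>"
    using r by (auto simp: mv_hom_def)
  have eq_if: "x = y" if "x \<in> carrier A" "y \<in> carrier A" "r x = r y"
    "\<tau> (x \<ominus> y) \<preceq>\<^sub>M x \<ominus> y" "\<tau> (y \<ominus> x) \<preceq>\<^sub>M y \<ominus> x" for x y
  proof -
    have "x \<ominus> y = \<zero>" "y \<ominus> x = \<zero>"
      using ker P_zero that by (simp_all add: ideal_rel_def)
    then show ?thesis
      using that(1,2) by (intro le_antisym) (simp_all add: diff_eq_zero_iff)
  qed
  have inj_tau: "\<tau> x = \<tau> y"
    if "x \<in> carrier A" "y \<in> carrier A" "r (\<tau> x) = r (\<tau> y)" for x y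
    using that by (intro eq_if[of "\<tau> x" "\<tau> y"]) (simp_all add: tau_diff tau_idem le_refl)
  have inj: "x = y"
    if "x \<in> carrier A" "y \<in> carrier A" "r (\<tau> x) = r (\<tau> y)" "r x = r y" for x y
  proof (rule eq_if[OF that(1,2,4)])
    have "\<tau> x \<ominus> \<tau> y = \<zero>" "\<tau> y \<ominus> \<tau> x = \<zero>"
      using that inj_tau[OF that(1-3)] by (simp_all add: diff_eq_zero_iff le_refl)
    then show "\<tau> (x \<ominus> y) \<preceq>\<^sub>M x \<ominus> y" "\<tau> (y \<ominus> x) \<preceq>\<^sub>M y \<ominus> x"
      using that by (simp_all add: tau_diff zero_le)
  qed
  define B where "B = (\<lambda>x. r (\<tau> x)) ` carrier A"
  have B: "mv_subuniverse B C"
    unfolding mv_subuniverse_def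
  proof (intro conjI ballI)
    show "B \<subseteq> carrier C"
      using onto by (auto simp: B_def)
    show "\<zero>\<^bsub>C\<^esub> \<in> B"
      unfolding B_def hom by (rule image_eqI[of _ _ "\<zero>"]) simp_all
    show "x \<oplus>\<^bsub>C\<^esub> y \<in> B" if xy: "x \<in> B" "y \<in> B" for x y
    proof -
      obtain a b where "a \<in> carrier A" "b \<in> carrier A" "x = r (\<tau> a)" "y = r (\<tau> b)"
        using xy unfolding B_def by blast
      then show ?thesis
        unfolding B_def by (intro image_eqI[of _ _ "a \<oplus> b"]) (simp_all add: hom tau_add)
    qed
    fix x assume "x \<in> B"
    then obtain a where "a \<in> carrier A" "x = r (\<tau> a)"
      unfolding B_def by blast
    then show "\<sim>\<^bsub>C\<^esub> x \<in> B"
      unfolding B_def by (intro image_eqI[of _ _ "\<sim> a"]) (simp_all add: hom tau_neg)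
  qed
  define D where "D = diagonal_algebra B C"
  define h where "h x = (r (\<tau> x), r x)" for x
  have "diagonal D"
    unfolding diagonal_def D_def using C B mv_chain_subuniverse[OF C B] by blast
  moreover have "smmv_subuniverse (h ` carrier A) D"
    unfolding smmv_subuniverse_def mv_subuniverse_def
  proof (intro conjI ballI)
    show "h ` carrier A \<subseteq> carrier D"
      using onto by (auto simp: D_def diagonal_algebra_def h_def B_def)
    show "\<zero>\<^bsub>D\<^esub> \<in> h ` carrier A"
      by (rule image_eqI[of _ _ "\<zero>"]) (simp_all add: D_def diagonal_algebra_def h_def hom)
    show "x \<oplus>\<^bsub>D\<^esub> y \<in> h ` carrier A" if xy: "x \<in> h ` carrier A" "y \<in> h ` carrier A" for x y
    proof -
      obtain a b where "a \<in> carrier A" "b \<in> carrier A" "x = h a" "y = h b"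
        using xy by blast
      then show ?thesis
        by (intro image_eqI[of _ _ "a \<oplus> b"])
          (simp_all add: D_def diagonal_algebra_def h_def hom tau_add)
    qed
    fix x assume "x \<in> h ` carrier A"
    then obtain a where "a \<in> carrier A" "x = h a"
      by auto
    then show "\<sim>\<^bsub>D\<^esub> x \<in> h ` carrier A"
      by (intro image_eqI[of _ _ "\<sim> a"])
        (simp_all add: D_def diagonal_algebra_def h_def hom tau_neg)
    show "\<tau>\<^bsub>D\<^esub> x \<in> h ` carrier A"
      using \<open>a \<in> carrier A\<close> \<open>x = h a\<close> by (intro image_eqI[of _ _ "\<tau> a"])
        (simp_all add: D_def diagonal_algebra_def h_def tau_idem)
  qed
  moreover have "h \<in> smmv_iso A (D\<lparr>carrier := h ` carrier A\<rparr>)"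
  proof -
    have "inj_on h (carrier A)"
      using inj by (auto simp: inj_on_def h_def)
    then show ?thesis
      unfolding smmv_iso_def mv_hom_def bij_betw_def
      by (simp add: D_def diagonal_algebra_def) (simp add: h_def hom tau_add tau_neg tau_idem)
  qed
  ultimately show ?thesis
    unfolding subdiagonal_def using A by blast
qed

theorem theorem3p9:
  fixes A :: "'a smmv_structure"
  assumes "smmv_algebra A"
    and "subdirectly_irreducible A"
  shows "subdiagonal TYPE('a) A"
proof -
  interpret smmv_algebra A by fact
  obtain m where m: "monolith_element A m"
    using monolith_element_exists[OF assms(2)] by blast
  show ?thesis
  proof (rule prime_ideal_imp_subdiagonal[OF assms(1)])
    show "mv_ideal (mv_polar A m) A"
      using m by (simp add: monolith_element_def polar_ideal)
    show "\<forall>x\<in>carrier A. \<forall>y\<in>carrier A.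
        x \<ominus>\<^bsub>A\<^esub> y \<in> mv_polar A m \<or> y \<ominus>\<^bsub>A\<^esub> x \<in> mv_polar A m"
      by (intro ballI monolith_polar_prime[OF m])
    show "\<forall>x\<in>mv_polar A m. \<tau>\<^bsub>A\<^esub> x \<preceq>\<^sub>M\<^bsub>A\<^esub> x \<longrightarrow> x = \<zero>\<^bsub>A\<^esub>"
      using monolith_polar_trivial[OF m] by blast
  qed
qed

end
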